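(* Consider a deterministic min-plus linear system with service process $S(\tau,t)$ that is super-additive. Fix $t>0$, and let the probe be the burst response $\widetilde{A}_{mp}(\tau)=S(0,\tau)$ for $\tau\in[0,t]$, with departures $D(t)=\inf_{\upsilon\in[0,t]}\{\widetilde{A}_{mp}(\upsilon)+S(\upsilon,t)\}$ and backlog $B(t)=\widetilde{A}_{mp}(t)-D(t)$. Then for all $\tau\in[0,t]$ $$D(t)-\widetilde{A}_{mp}(\tau)\ \le\ S(\tau,t)\ \le\ S(0,t)-S(0,\tau),$$ and the difference between the upper and the lower estimate equals, for every $\tau\in[0,t]$, $$\Delta(0,t)=S(0,t)-\inf_{\upsilon\in[0,t]}\{S(0,\upsilon)+S(\upsilon,t)\}=B(t).$$ In particular, if $S$ is additive then $\Delta(0,t)=0$, i.e., both the lower and the upper estimate equal $S(\tau,t)$ for all $\tau\in[0,t]$, and the backlog $B(\tau)=\widetilde{A}_{mp}(\tau)-D(\tau)$ is zero for all $\tau\in[0,t]$, where $D(\tau)=\inf_{\upsilon\in[0,\tau]}\{\widetilde{A}_{mp}(\upsilon)+S(\upsilon,\tau)\}$.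
   Context: The service process $S(\tau,t)$, $0\le\tau\le t$, is a non-negative real-valued function with $S(t,t)=0$ for all $t\ge0$. It is super-additive if $S(s,u)\ge S(s,t)+S(t,u)$, and additive if $S(s,u)=S(s,t)+S(t,u)$, for all $u\ge t\ge s\ge0$. $\Delta(0,t)$ is the maximal deviation of $S(0,t)$ from additivity. *)

theory Defs
  imports Complex_Main
begin

text \<open>
  Time is the non-negative half-line. A bivariate process is a total function on the reals, of which
  only the values \<^term>\<open>S \<tau> t\<close> with \<open>0 \<le> \<tau> \<le> t\<close> are meaningful; every definition below
  inspects only those.
\<close>

definition service_process :: "(real \<Rightarrow> real \<Rightarrow> real) \<Rightarrow> bool" where
  "service_process S \<longleftrightarrow>
     (\<forall>\<tau> t. 0 \<le> \<tau> \<and> \<tau> \<le> t \<longrightarrow> 0 \<le> S \<tau> t) \<and> (\<forall>t\<ge>0. S t t = 0)"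

definition super_additive :: "(real \<Rightarrow> real \<Rightarrow> real) \<Rightarrow> bool" where
  "super_additive S \<longleftrightarrow>
     (\<forall>s t u. 0 \<le> s \<and> s \<le> t \<and> t \<le> u \<longrightarrow> S s u \<ge> S s t + S t u)"

text \<open>Not to be confused with the one-argument \<open>additive\<close> of the library.\<close>

definition additive_process :: "(real \<Rightarrow> real \<Rightarrow> real) \<Rightarrow> bool" where
  "additive_process S \<longleftrightarrow>
     (\<forall>s t u. 0 \<le> s \<and> s \<le> t \<and> t \<le> u \<longrightarrow> S s u = S s t + S t u)"

text \<open>
  The min-plus linear system with service process \<open>S\<close>, as an operator from arrivals to departures.
  For non-negative arrivals the infimum is over a non-empty set bounded below by zero.
\<close>

definition departures :: "(real \<Rightarrow> real \<Rightarrow> real) \<Rightarrow> (real \<Rightarrow> real) \<Rightarrow> real \<Rightarrow> real" where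
  "departures S A t = (INF \<upsilon>\<in>{0..t}. A \<upsilon> + S \<upsilon> t)"

definition backlog :: "(real \<Rightarrow> real \<Rightarrow> real) \<Rightarrow> (real \<Rightarrow> real) \<Rightarrow> real \<Rightarrow> real" where
  "backlog S A t = A t - departures S A t"

text \<open>
  The maximal deviation of \<^term>\<open>S s t\<close> from additivity. For a service process the supremum is over
  a non-empty set bounded above by \<^term>\<open>S s t\<close>.
\<close>

definition max_deviation :: "(real \<Rightarrow> real \<Rightarrow> real) \<Rightarrow> real \<Rightarrow> real \<Rightarrow> real" where
  "max_deviation S s t = (SUP \<upsilon>\<in>{s..t}. S s t - (S s \<upsilon> + S \<upsilon> t))"

end

theory Submission
  imports Defs
begin

text \<open>Since \<open>A\<close> agrees with \<open>S 0\<close> on \<open>{0..t}\<close>,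
  \<open>departures S A t\<close> is the infimum of the split costs
  \<open>S 0 \<upsilon> + S \<upsilon> t\<close>. The lower estimate holds because an infimum is at
  most its value at \<open>\<upsilon> = \<tau>\<close>; the upper one is super-additivity at
  \<open>0 \<le> \<tau> \<le> t\<close>. In their difference the terms \<open>S 0 \<tau>\<close> and
  \<open>A \<tau>\<close> cancel, leaving \<open>S 0 t - departures S A t\<close> for every
  \<open>\<tau>\<close>. This is the backlog because \<open>A t = S 0 t\<close>, and the maximal
  deviation by \<open>SUP_diff_eq_diff_INF\<close>. If \<open>S\<close> is additive, all splits cost
  the same, so the infimum is attained everywhere and the gap closes.\<close>

text \<open>Reflection at \<open>c\<close> reverses the order: \<open>y\<close> bounds all
  \<open>c - f i\<close> above exactly when \<open>c - y\<close> bounds all \<open>f i\<close>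
  below. The assumptions ensure that the infimum is a genuine greatest lower bound.\<close>

lemma SUP_diff_eq_diff_INF:
  fixes f :: "'a \<Rightarrow> real"
  assumes "I \<noteq> {}" "bdd_below (f ` I)"
  shows "(SUP i\<in>I. c - f i) = c - (INF i\<in>I. f i)"
proof (rule cSup_eq_non_empty)
  show "(\<lambda>i. c - f i) ` I \<noteq> {}" using assms by simp
next
  fix x assume "x \<in> (\<lambda>i. c - f i) ` I"
  then show "x \<le> c - (INF i\<in>I. f i)"
    using assms(2) by (auto intro: cINF_lower)
next
  fix y assume "\<And>x. x \<in> (\<lambda>i. c - f i) ` I \<Longrightarrow> x \<le> y"
  then have "c - y \<le> f i" if "i \<in> I" for i
    using that by (force simp: algebra_simps)
  then have "c - y \<le> (INF i\<in>I. f i)"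
    using assms(1) by (intro cINF_greatest)
  then show "c - (INF i\<in>I. f i) \<le> y" by simp
qed

lemma service_process_bdd_below:
  assumes "service_process S"
  shows "bdd_below ((\<lambda>\<upsilon>. S 0 \<upsilon> + S \<upsilon> t) ` {0..t})"
  using assms by (intro bdd_belowI2[of _ 0]) (auto simp: service_process_def)

text \<open>The infimum inspects the probe only on \<open>{0..t}\<close>, where its values are
  prescribed.\<close>

lemma departures_burst_response:
  assumes "\<forall>\<tau>\<in>{0..t}. A \<tau> = S 0 \<tau>"
  shows "departures S A t = (INF \<upsilon>\<in>{0..t}. S 0 \<upsilon> + S \<upsilon> t)"
  unfolding departures_def using assms by (intro INF_cong) auto

lemma departures_burst_response_le:
  assumes "service_process S" "\<forall>\<tau>\<in>{0..t}. A \<tau> = S 0 \<tau>" "\<tau> \<in> {0..t}"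
  shows "departures S A t \<le> S 0 \<tau> + S \<tau> t"
  unfolding departures_burst_response[of t A S, OF assms(2)]
  by (rule cINF_lower[OF service_process_bdd_below[OF assms(1)] assms(3)])

lemma max_deviation_burst_response:
  assumes "service_process S" "t \<ge> 0"
  shows "max_deviation S 0 t = S 0 t - (INF \<upsilon>\<in>{0..t}. S 0 \<upsilon> + S \<upsilon> t)"
  unfolding max_deviation_def using assms
  by (intro SUP_diff_eq_diff_INF service_process_bdd_below) auto

text \<open>Every split of the interval costs \<open>S 0 t\<close>, so the infimum is that of a
  constant over a non-empty set.\<close>

lemma departures_burst_response_additive:
  assumes "additive_process S" "\<forall>\<tau>\<in>{0..t}. A \<tau> = S 0 \<tau>" "t \<ge> 0"
  shows "departures S A t = S 0 t"
proof -
  have "S 0 \<upsilon> + S \<upsilon> t = S 0 t" if "\<upsilon> \<in> {0..t}" for \<upsilon>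
    using assms(1) that by (simp add: additive_process_def)
  then have "departures S A t = (INF \<upsilon>\<in>{0..t}. S 0 t)"
    unfolding departures_burst_response[of t A S, OF assms(2)] by (intro INF_cong) auto
  then show ?thesis using assms(3) by simp
qed

theorem mainTheorem10:
  fixes S :: "real \<Rightarrow> real \<Rightarrow> real" and A :: "real \<Rightarrow> real" and t :: real
  assumes "service_process S"
    and "super_additive S"
    and "t > 0"
    and "\<forall>\<tau>\<in>{0..t}. A \<tau> = S 0 \<tau>"
  shows "(\<forall>\<tau>\<in>{0..t}. departures S A t - A \<tau> \<le> S \<tau> t \<and> S \<tau> t \<le> S 0 t - S 0 \<tau>)
    \<and> (\<forall>\<tau>\<in>{0..t}. (S 0 t - S 0 \<tau>) - (departures S A t - A \<tau>) = max_deviation S 0 t)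
    \<and> max_deviation S 0 t = S 0 t - (INF \<upsilon>\<in>{0..t}. S 0 \<upsilon> + S \<upsilon> t)
    \<and> max_deviation S 0 t = backlog S A t
    \<and> (additive_process S \<longrightarrow>
         max_deviation S 0 t = 0
       \<and> (\<forall>\<tau>\<in>{0..t}. departures S A t - A \<tau> = S \<tau> t \<and> S 0 t - S 0 \<tau> = S \<tau> t)
       \<and> (\<forall>\<tau>\<in>{0..t}. backlog S A \<tau> = 0))"
proof (intro conjI ballI impI)
  have t: "0 \<le> t" using assms(3) by simp
  have dep: "departures S A t = (INF \<upsilon>\<in>{0..t}. S 0 \<upsilon> + S \<upsilon> t)"
    by (rule departures_burst_response[of t A S, OF assms(4)])
  show dev: "max_deviation S 0 t = S 0 t - (INF \<upsilon>\<in>{0..t}. S 0 \<upsilon> + S \<upsilon> t)"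
    by (rule max_deviation_burst_response[OF assms(1) t])
  show "max_deviation S 0 t = backlog S A t"
    using dev dep assms(4) t by (simp add: backlog_def)
  show "departures S A t - A \<tau> \<le> S \<tau> t" if "\<tau> \<in> {0..t}" for \<tau>
    using departures_burst_response_le[of S t A, OF assms(1,4) that] assms(4) that by simp
  \<comment> \<open>Super-additivity with the interval from \<open>0\<close> to \<open>t\<close>
    split at \<open>\<tau>\<close>.\<close>
  show "S \<tau> t \<le> S 0 t - S 0 \<tau>" if "\<tau> \<in> {0..t}" for \<tau>
    using assms(2) that unfolding super_additive_def
    by (metis add.commute atLeastAtMost_iff le_diff_eq order_refl)
  show "(S 0 t - S 0 \<tau>) - (departures S A t - A \<tau>) = max_deviation S 0 t"
    if "\<tau> \<in> {0..t}" for \<tau>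
    using dev dep assms(4) that by simp
  assume add: "additive_process S"
  \<comment> \<open>The lemma is used at each horizon \<open>\<tau>\<close>, not only at
    \<open>t\<close>: agreement of \<open>A\<close> with \<open>S 0\<close> restricts to
    \<open>{0..\<tau>}\<close>. This gives zero backlog at all times up to \<open>t\<close>.\<close>
  have dep_add: "departures S A \<tau> = S 0 \<tau>" if "\<tau> \<in> {0..t}" for \<tau>
    using departures_burst_response_additive[of S \<tau> A, OF add] assms(4) that by simp
  show "max_deviation S 0 t = 0"
    using dev dep dep_add t by simp
  show upper: "S 0 t - S 0 \<tau> = S \<tau> t" if "\<tau> \<in> {0..t}" for \<tau>
    using add that by (simp add: additive_process_def)
  show "departures S A t - A \<tau> = S \<tau> t" if "\<tau> \<in> {0..t}" for \<tau>
    using upper dep_add t assms(4) that by simp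
  show "backlog S A \<tau> = 0" if "\<tau> \<in> {0..t}" for \<tau>
    using dep_add assms(4) that by (simp add: backlog_def)
qed

end
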